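(* Let $\mu:\mathbb{Z}\to\mathbb{R}^+$ be a growth rate. If the system $x(k+1)=A(k)x(k)$, $k\in\mathbb{Z}$, admits a $\mu$-dichotomy, then it does not have $\omega$-bounded growth for any growth rate $\omega:\mathbb{Z}\to\mathbb{R}^+$ which is slower than $\mu$.
   Context: System: $A:\mathbb{Z}\to GL_d(\mathbb{R})$, and $x(k+1)=A(k)x(k)$, $k\in\mathbb{Z}$. Its evolution operator is $\Phi(k,n)=A(k-1)\cdots A(n)$ for $k>n$, $\Phi(n,n)=\mathrm{Id}$, $\Phi(k,n)=A^{-1}(k)\cdots A^{-1}(n-1)$ for $k<n$. Growth rate: a non-decreasing map $\mu:\mathbb{Z}\to\mathbb{R}^+=(0,\infty)$ with $\mu(0)=1$, $\lim_{n\to+\infty}\mu(n)=+\infty$, $\lim_{n\to-\infty}\mu(n)=0$. Faster/slower: $\mu$ is faster than $\omega$, equivalently $\omega$ is slower than $\mu$, if for every $\alpha,\tilde\alpha<0$ there is $M\ge1$ such that $\left(\frac{\mu(k)}{\mu(n)}\right)^{\alpha}\le M\left(\frac{\omega(k)}{\omega(n)}\right)^{\tilde\alpha}$ for all integers $k\ge n$. Invariant projector: a map $n\mapsto \mathrm{P}(n)$ of idempotent $d\times d$ matrices with $A(k)\mathrm{P}(k)=\mathrm{P}(k+1)A(k)$ for all $k\in\mathbb{Z}$. $\mu$-dichotomy: there are an invariant projector $\mathrm{P}$ and constants $K\ge1$, $\alpha<0$, $\beta>0$ with $\|\Phi(k,n)\mathrm{P}(n)\|\le K\left(\frac{\mu(k)}{\mu(n)}\right)^{\alpha}$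 for all $k\ge n$ and $\|\Phi(k,n)[\mathrm{Id}-\mathrm{P}(n)]\|\le K\left(\frac{\mu(k)}{\mu(n)}\right)^{\beta}$ for all $k\le n$. $\omega$-bounded growth: there are constants $\hat K\ge1$, $a\ge0$ with $\|\Phi(k,n)\|\le\hat K\left(\frac{\omega(k)}{\omega(n)}\right)^{\mathrm{sgn}(k-n)a}$ for all $k,n\in\mathbb{Z}$, where $\mathrm{sgn}(j)=1,0,-1$ for $j>0$, $j=0$, $j<0$ respectively. *)

theory Defs
  imports "HOL-Analysis.Analysis"
begin

definition growth_rate :: "(int \<Rightarrow> real) \<Rightarrow> bool" where
  "growth_rate \<mu> \<longleftrightarrow>
     (\<forall>k. 0 < \<mu> k) \<and> mono \<mu> \<and> \<mu> 0 = 1 \<and>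
     filterlim \<mu> at_top at_top \<and> (\<mu> \<longlongrightarrow> 0) at_bot"

definition faster :: "(int \<Rightarrow> real) \<Rightarrow> (int \<Rightarrow> real) \<Rightarrow> bool" where
  "faster \<mu> \<omega> \<longleftrightarrow>
     (\<forall>\<alpha><0. \<forall>\<alpha>'<0. \<exists>M\<ge>1. \<forall>k n. n \<le> k \<longrightarrow>
        (\<mu> k / \<mu> n) powr \<alpha> \<le> M * (\<omega> k / \<omega> n) powr \<alpha>')"

definition slower :: "(int \<Rightarrow> real) \<Rightarrow> (int \<Rightarrow> real) \<Rightarrow> bool" where
  "slower \<omega> \<mu> \<longleftrightarrow> faster \<mu> \<omega>"

text \<open>The norm of a matrix is the operator norm induced by the Euclidean norm; the library's
  \<^const>\<open>norm\<close> on matrices is the (equivalent) Frobenius norm.\<close>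

definition opnorm :: "real ^ 'n ^ 'n \<Rightarrow> real" where
  "opnorm B = onorm (\<lambda>x. B *v x)"

text \<open>\<open>forward_evolution A n m\<close> is \<open>A (n + m - 1) ** \<dots> ** A n\<close> and
  \<open>backward_evolution A n m\<close> is \<open>A\<inverse> (n - m) ** \<dots> ** A\<inverse> (n - 1)\<close>, with \<open>m\<close> factors each.\<close>

primrec forward_evolution :: "(int \<Rightarrow> real ^ 'n ^ 'n) \<Rightarrow> int \<Rightarrow> nat \<Rightarrow> real ^ 'n ^ 'n" where
  "forward_evolution A n 0 = mat 1"
| "forward_evolution A n (Suc m) = A (n + int m) ** forward_evolution A n m"

primrec backward_evolution :: "(int \<Rightarrow> real ^ 'n ^ 'n) \<Rightarrow> int \<Rightarrow> nat \<Rightarrow> real ^ 'n ^ 'n" where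
  "backward_evolution A n 0 = mat 1"
| "backward_evolution A n (Suc m) =
     matrix_inv (A (n - int (Suc m))) ** backward_evolution A n m"

definition evolution :: "(int \<Rightarrow> real ^ 'n ^ 'n) \<Rightarrow> int \<Rightarrow> int \<Rightarrow> real ^ 'n ^ 'n" where
  "evolution A k n =
     (if n \<le> k then forward_evolution A n (nat (k - n))
      else backward_evolution A n (nat (n - k)))"

definition invariant_projector ::
    "(int \<Rightarrow> real ^ 'n ^ 'n) \<Rightarrow> (int \<Rightarrow> real ^ 'n ^ 'n) \<Rightarrow> bool" where
  "invariant_projector A P \<longleftrightarrow>
     (\<forall>k. P k ** P k = P k) \<and> (\<forall>k. A k ** P k = P (k + 1) ** A k)"

definition dichotomy :: "(int \<Rightarrow> real) \<Rightarrow> (int \<Rightarrow> real ^ 'n ^ 'n) \<Rightarrow> bool" where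
  "dichotomy \<mu> A \<longleftrightarrow>
     (\<exists>P K \<alpha> \<beta>. invariant_projector A P \<and> K \<ge> 1 \<and> \<alpha> < 0 \<and> \<beta> > 0 \<and>
        (\<forall>k n. n \<le> k \<longrightarrow>
           opnorm (evolution A k n ** P n) \<le> K * (\<mu> k / \<mu> n) powr \<alpha>) \<and>
        (\<forall>k n. k \<le> n \<longrightarrow>
           opnorm (evolution A k n ** (mat 1 - P n)) \<le> K * (\<mu> k / \<mu> n) powr \<beta>))"

definition bounded_growth :: "(int \<Rightarrow> real) \<Rightarrow> (int \<Rightarrow> real ^ 'n ^ 'n) \<Rightarrow> bool" where
  "bounded_growth \<omega> A \<longleftrightarrow>
     (\<exists>K a. K \<ge> 1 \<and> a \<ge> 0 \<and>
        (\<forall>k n. opnorm (evolution A k n)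
           \<le> K * (\<omega> k / \<omega> n) powr (real_of_int (sgn (k - n)) * a)))"

end

theory Submission imports Defs
begin

text \<open>Since \<open>\<Phi>(0,k) \<Phi>(k,0) = Id\<close>, a matrix \<open>Q\<close> satisfies
  \<open>\<parallel>Q\<parallel> \<le> \<parallel>\<Phi>(0,k)\<parallel> \<parallel>\<Phi>(k,0) Q\<parallel>\<close> for every \<open>k\<close>: if \<open>\<Phi>(k,0) Q\<close> decays, then
  the evolution operator back to time \<open>0\<close> must grow at least at the reciprocal rate.
  For \<open>Q = P(0)\<close> and \<open>k \<rightarrow> \<infinity>\<close> the dichotomy makes the second factor \<open>O(\<mu>(k)\<^sup>\<alpha>)\<close>, while
  \<open>\<omega>\<close>-bounded growth makes the first one \<open>O(\<omega>(k)\<^sup>a)\<close>. Because \<open>\<mu>\<close> is faster than \<open>\<omega>\<close>,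
  \<open>\<mu>(k)\<^sup>\<alpha>\<close> is dominated by \<open>\<omega>(k)\<close> raised to the power \<open>-(a + 1)\<close>, so the product is
  \<open>O(1 / \<omega>(k))\<close> and tends to \<open>0\<close>; hence \<open>P(0) = 0\<close>. For \<open>Q = Id - P(0)\<close> and
  \<open>k \<rightarrow> -\<infinity>\<close> the product is, in the same way, \<open>O(\<omega>(k))\<close>, which also tends to \<open>0\<close>;
  hence \<open>Id - P(0) = 0\<close>. The sum of the two projections is then both \<open>Id\<close> and \<open>0\<close>, which is
  absurd.\<close>

lemma opnorm_mult_le: "opnorm (B ** C) \<le> opnorm B * opnorm C"
  using onorm_compose[of "\<lambda>x. B *v x" "\<lambda>x. C *v x"]
  by (simp add: opnorm_def o_def matrix_vector_mul_assoc matrix_vector_mul_bounded_linear)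

lemma opnorm_nonneg: "0 \<le> opnorm B"
  by (simp add: opnorm_def onorm_pos_le matrix_vector_mul_bounded_linear)

lemma opnorm_le_0_iff: "opnorm B \<le> 0 \<longleftrightarrow> B = 0"
proof
  assume "opnorm B \<le> 0"
  then have "opnorm B = 0"
    using opnorm_nonneg[of B] by simp
  then have "\<forall>x. B *v x = 0 *v x"
    by (simp add: opnorm_def onorm_eq_0 matrix_vector_mul_bounded_linear)
  then show "B = 0"
    by (simp add: matrix_eq)
qed (simp add: opnorm_def onorm_zero)

lemma invertible_matrix_inv:
  assumes "invertible B"
  shows "B ** matrix_inv B = mat 1" and "matrix_inv B ** B = mat 1"
  using someI_ex[OF assms[unfolded invertible_def]] by (auto simp: matrix_inv_def)

text \<open>The defining recursion adds factors on the left; to cancel against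
  \<^const>\<open>backward_evolution\<close>, whose newest factor is the inverse of the oldest matrix of the
  forward product, the rightmost factor has to be split off instead.\<close>

lemma forward_evolution_Suc_right:
  "forward_evolution A n (Suc m) = forward_evolution A (n + 1) m ** A n"
proof (induction m)
  case (Suc m)
  then show ?case
    by (simp add: matrix_mul_assoc algebra_simps)
qed simp

lemma backward_forward_evolution:
  assumes "\<And>k. invertible (A k)"
  shows "backward_evolution A (n + int m) m ** forward_evolution A n m = mat 1"
proof (induction m arbitrary: n)
  case (Suc m)
  have "backward_evolution A (n + int (Suc m)) (Suc m) ** forward_evolution A n (Suc m)
      = matrix_inv (A n) ** backward_evolution A (n + 1 + int m) m
        ** (forward_evolution A (n + 1) m ** A n)"
    unfolding forward_evolution_Suc_right by (simp add: algebra_simps)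
  also have "\<dots> = matrix_inv (A n)
      ** (backward_evolution A (n + 1 + int m) m ** forward_evolution A (n + 1) m) ** A n"
    by (simp add: matrix_mul_assoc)
  also have "\<dots> = mat 1"
    by (simp add: Suc.IH invertible_matrix_inv assms)
  finally show ?case .
qed simp

lemma forward_backward_evolution:
  assumes "\<And>k. invertible (A k)"
  shows "forward_evolution A (n - int m) m ** backward_evolution A n m = mat 1"
proof (induction m)
  case (Suc m)
  let ?j = "n - int (Suc m)"
  have "forward_evolution A ?j (Suc m) ** backward_evolution A n (Suc m)
      = forward_evolution A (n - int m) m ** A ?j
        ** (matrix_inv (A ?j) ** backward_evolution A n m)"
    unfolding forward_evolution_Suc_right by simp
  also have "\<dots> = forward_evolution A (n - int m) m ** (A ?j ** matrix_inv (A ?j))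
      ** backward_evolution A n m"
    by (simp only: matrix_mul_assoc)
  also have "\<dots> = mat 1"
    using Suc.IH by (simp add: invertible_matrix_inv assms)
  finally show ?case .
qed simp

lemma evolution_inverse:
  assumes "\<And>k. invertible (A k)"
  shows "evolution A n k ** evolution A k n = mat 1"
proof -
  consider "n < k" | "n = k" | "k < n"
    by linarith
  then show ?thesis
  proof cases
    case 1
    then show ?thesis
      using backward_forward_evolution[OF assms, where n = n and m = "nat (k - n)"]
      by (simp add: evolution_def)
  next
    case 3
    then show ?thesis
      using forward_backward_evolution[OF assms, where n = n and m = "nat (n - k)"]
      by (simp add: evolution_def)
  qed (simp add: evolution_def)
qed

lemma opnorm_le_evolution_round_trip:
  assumes "\<And>k. invertible (A k)"
  shows "opnorm Q \<le> opnorm (evolution A n k) * opnorm (evolution A k n ** Q)"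
proof -
  have "Q = evolution A n k ** (evolution A k n ** Q)"
    by (simp add: matrix_mul_assoc evolution_inverse[OF assms])
  then show ?thesis
    by (metis opnorm_mult_le)
qed

lemma opnorm_le_tendsto_0_imp_eq_0:
  fixes g :: "int \<Rightarrow> real"
  assumes "F \<noteq> bot" and "(g \<longlongrightarrow> 0) F" and "eventually (\<lambda>k. opnorm Q \<le> C * g k) F"
  shows "Q = 0"
proof -
  have "((\<lambda>k. C * g k) \<longlongrightarrow> 0) F"
    using tendsto_mult_right_zero[OF assms(2)] .
  then have "opnorm Q \<le> 0"
    using tendsto_lowerbound assms(1,3) by blast
  then show ?thesis
    by (simp add: opnorm_le_0_iff)
qed

text \<open>The exponent \<open>-(a + 1)\<close> in the comparison of rates leaves one spare power of
  \<open>\<omega>\<close> after the growth \<open>\<omega>\<^sup>a\<close> of the evolution operator has been absorbed; this spare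
  power forces the limit \<open>0\<close>, also when \<open>a = 0\<close>.\<close>

lemma forward_decay_imp_eq_0:
  fixes A :: "int \<Rightarrow> real ^ 'n ^ 'n"
  assumes A: "\<And>k. invertible (A k)" and \<omega>: "growth_rate \<omega>" and slow: "slower \<omega> \<mu>"
    and bg: "bounded_growth \<omega> A" and "\<alpha> < 0" and "0 \<le> K"
    and decay: "\<And>k. 0 \<le> k \<Longrightarrow> opnorm (evolution A k 0 ** Q) \<le> K * (\<mu> k / \<mu> 0) powr \<alpha>"
  shows "Q = 0"
proof -
  from bg obtain L a where "L \<ge> 1" "a \<ge> 0"
    and L: "\<And>k n. opnorm (evolution A k n) \<le> L * (\<omega> k / \<omega> n) powr (real_of_int (sgn (k - n)) * a)"
    unfolding bounded_growth_def by blast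
  have "- (a + 1) < 0"
    using \<open>a \<ge> 0\<close> by simp
  with slow \<open>\<alpha> < 0\<close> obtain M where "M \<ge> 1"
    and M: "\<And>k n. n \<le> k \<Longrightarrow> (\<mu> k / \<mu> n) powr \<alpha> \<le> M * (\<omega> k / \<omega> n) powr (- (a + 1))"
    unfolding slower_def faster_def by blast
  have \<omega>_pos: "0 < \<omega> k" and \<omega>_0: "\<omega> 0 = 1" for k
    using \<omega> by (auto simp: growth_rate_def)
  have bound: "opnorm Q \<le> (L * K * M) * inverse (\<omega> k)" if "0 < k" for k
  proof -
    have "opnorm (evolution A 0 k) \<le> L * \<omega> k powr a"
      using L[of 0 k] that \<omega>_pos[of k] by (simp add: \<omega>_0 powr_divide powr_minus_divide)
    moreover have "opnorm (evolution A k 0 ** Q) \<le> K * (M * \<omega> k powr (- (a + 1)))"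
      using decay[of k] mult_left_mono[OF M[of 0 k] \<open>0 \<le> K\<close>] that by (simp add: \<omega>_0)
    ultimately have "opnorm Q \<le> (L * \<omega> k powr a) * (K * (M * \<omega> k powr (- (a + 1))))"
      by (intro order_trans[OF opnorm_le_evolution_round_trip[OF A, where Q = Q and n = 0 and k = k]]
          mult_mono' opnorm_nonneg)
    also have "\<dots> = (L * K * M) * (\<omega> k powr a * \<omega> k powr (- (a + 1)))"
      by simp
    also have "\<omega> k powr a * \<omega> k powr (- (a + 1)) = inverse (\<omega> k)"
      using \<omega>_pos[of k] by (simp flip: powr_add add: powr_minus)
    finally show ?thesis .
  qed
  have "((\<lambda>k. inverse (\<omega> k)) \<longlongrightarrow> 0) at_top"
    using \<omega> by (auto simp: growth_rate_def intro: tendsto_inverse_0_at_top)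
  moreover have "eventually (\<lambda>k. opnorm Q \<le> (L * K * M) * inverse (\<omega> k)) at_top"
    using eventually_gt_at_top[of "0::int"] by (rule eventually_mono) (rule bound)
  ultimately show ?thesis
    by (rule opnorm_le_tendsto_0_imp_eq_0[rotated]) simp
qed

text \<open>Here the comparison of rates is read off for the pair \<open>0 \<ge> k\<close> with the exponent
  \<open>- \<beta>\<close>: the ratios are inverted, so it turns into a bound on \<open>\<mu>(k)\<^sup>\<beta>\<close> by a multiple of
  \<open>\<omega>(k)\<close> to the power \<open>a + 1\<close>, and the spare power is now \<open>\<omega>(k)\<close> itself, which vanishes at
  \<open>-\<infinity>\<close>.\<close>

lemma backward_decay_imp_eq_0:
  fixes A :: "int \<Rightarrow> real ^ 'n ^ 'n"
  assumes A: "\<And>k. invertible (A k)" and \<mu>: "growth_rate \<mu>" and \<omega>: "growth_rate \<omega>"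
    and slow: "slower \<omega> \<mu>" and bg: "bounded_growth \<omega> A" and "\<beta> > 0" and "0 \<le> K"
    and decay: "\<And>k. k \<le> 0 \<Longrightarrow> opnorm (evolution A k 0 ** Q) \<le> K * (\<mu> k / \<mu> 0) powr \<beta>"
  shows "Q = 0"
proof -
  from bg obtain L a where "L \<ge> 1" "a \<ge> 0"
    and L: "\<And>k n. opnorm (evolution A k n) \<le> L * (\<omega> k / \<omega> n) powr (real_of_int (sgn (k - n)) * a)"
    unfolding bounded_growth_def by blast
  have "- (a + 1) < 0" "- \<beta> < 0"
    using \<open>a \<ge> 0\<close> \<open>\<beta> > 0\<close> by simp_all
  with slow obtain M where "M \<ge> 1"
    and M: "\<And>k n. n \<le> k \<Longrightarrow> (\<mu> k / \<mu> n) powr (- \<beta>) \<le> M * (\<omega> k / \<omega> n) powr (- (a + 1))"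
    unfolding slower_def faster_def by blast
  have \<omega>_pos: "0 < \<omega> k" and \<omega>_0: "\<omega> 0 = 1" and \<mu>_pos: "0 < \<mu> k" and \<mu>_0: "\<mu> 0 = 1" for k
    using \<omega> \<mu> by (auto simp: growth_rate_def)
  have bound: "opnorm Q \<le> (L * K * M) * \<omega> k" if "k < 0" for k
  proof -
    have "opnorm (evolution A 0 k) \<le> L * \<omega> k powr (- a)"
      using L[of 0 k] that \<omega>_pos[of k] by (simp add: \<omega>_0 powr_divide powr_minus_divide)
    moreover have "\<mu> k powr \<beta> \<le> M * \<omega> k powr (a + 1)"
      using M[of k 0] that \<omega>_pos[of k] \<mu>_pos[of k]
      by (simp add: \<omega>_0 \<mu>_0 powr_divide powr_minus_divide powr_diff powr_add)
    then have "opnorm (evolution A k 0 ** Q) \<le> K * (M * \<omega> k powr (a + 1))"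
      using that \<open>0 \<le> K\<close> by (intro order_trans[OF decay] mult_left_mono) (simp_all add: \<mu>_0)
    ultimately have "opnorm Q \<le> (L * \<omega> k powr (- a)) * (K * (M * \<omega> k powr (a + 1)))"
      by (intro order_trans[OF opnorm_le_evolution_round_trip[OF A, where Q = Q and n = 0 and k = k]]
          mult_mono' opnorm_nonneg)
    also have "\<dots> = (L * K * M) * (\<omega> k powr (- a) * \<omega> k powr (a + 1))"
      by simp
    also have "\<omega> k powr (- a) * \<omega> k powr (a + 1) = \<omega> k"
      using \<omega>_pos[of k] by (simp flip: powr_add)
    finally show ?thesis .
  qed
  have "(\<omega> \<longlongrightarrow> 0) at_bot"
    using \<omega> by (simp add: growth_rate_def)
  moreover have "eventually (\<lambda>k. opnorm Q \<le> (L * K * M) * \<omega> k) at_bot"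
    using eventually_le_at_bot[of "-1::int"] by (rule eventually_mono) (simp add: bound)
  ultimately show ?thesis
    by (rule opnorm_le_tendsto_0_imp_eq_0[rotated]) simp
qed

theorem corollary3p8:
  fixes A :: "int \<Rightarrow> real ^ 'n ^ 'n" and \<mu> :: "int \<Rightarrow> real"
  assumes "\<And>k. invertible (A k)"
    and "growth_rate \<mu>"
    and "dichotomy \<mu> A"
  shows "\<forall>\<omega> :: int \<Rightarrow> real. growth_rate \<omega> \<and> slower \<omega> \<mu> \<longrightarrow> \<not> bounded_growth \<omega> A"
proof (intro allI impI notI)
  fix \<omega> :: "int \<Rightarrow> real"
  assume "growth_rate \<omega> \<and> slower \<omega> \<mu>" and bg: "bounded_growth \<omega> A"
  then have \<omega>: "growth_rate \<omega>" "slower \<omega> \<mu>"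
    by auto
  from assms(3) obtain P K \<alpha> \<beta> where K: "K \<ge> 1" and "\<alpha> < 0" "\<beta> > 0"
    and stable: "\<And>k n. n \<le> k \<Longrightarrow> opnorm (evolution A k n ** P n) \<le> K * (\<mu> k / \<mu> n) powr \<alpha>"
    and unstable: "\<And>k n. k \<le> n \<Longrightarrow>
      opnorm (evolution A k n ** (mat 1 - P n)) \<le> K * (\<mu> k / \<mu> n) powr \<beta>"
    unfolding dichotomy_def by blast
  have "0 \<le> K"
    using K by simp
  have "P 0 = 0"
    by (rule forward_decay_imp_eq_0[OF assms(1) \<omega> bg \<open>\<alpha> < 0\<close> \<open>0 \<le> K\<close> stable])
  moreover have "mat 1 - P 0 = 0"
    by (rule backward_decay_imp_eq_0[OF assms(1,2) \<omega> bg \<open>\<beta> > 0\<close> \<open>0 \<le> K\<close> unstable])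
  ultimately have "(mat 1 :: real ^ 'n ^ 'n) = 0"
    by simp
  then have "(mat 1 :: real ^ 'n ^ 'n) $ undefined $ undefined = 0"
    by (simp only: zero_index)
  then show False
    by (simp add: mat_def)
qed

end
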